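(* Let $n\ge3$ be an integer. There exists a constant $c>0$ depending only on $n$ such that for every integer $H\ge1$, $$\sum_{k=3}^nA_n^*(k,H)\le c\,H^n.$$
   Context: The height of a polynomial $f(X)=a_0X^n+a_1X^{n-1}+\cdots+a_n$ is $H(f)=\max_{0\le j\le n}|a_j|$. If $f\in\mathbb{C}[X]$ has degree $n\ge1$ and its roots, listed with multiplicities, are labelled so that $|\alpha_1|\ge|\alpha_2|\ge\cdots\ge|\alpha_n|$, then $f$ is said to have exactly $k$ roots with maximal modulus if $|\alpha_1|=\cdots=|\alpha_k|$ and either $k=n$ or $|\alpha_k|>|\alpha_{k+1}|$. For positive integers $n,k,H$ with $k\le n$, $A_n^*(k,H)$ denotes the number of polynomials $f(X)=a_0X^n+a_1X^{n-1}+\cdots+a_n\in\mathbb{Z}[X]$ with $a_0\ne0$, $H(f)\le H$, having exactly $k$ roots with maximal modulus. *)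

theory Defs
  imports Complex_Main "HOL-Computational_Algebra.Computational_Algebra"
begin

definition height :: "int poly \<Rightarrow> int" where
  "height f = Max ((\<lambda>j. \<bar>coeff f j\<bar>) ` {..degree f})"

(* The labelling \<alpha>_1, ..., \<alpha>_n is the list rs, so \<alpha>_i is rs ! (i - 1). The choice among
   labellings is immaterial: they all have the same list of moduli. *)
definition exactly_max_modulus_roots :: "nat \<Rightarrow> complex poly \<Rightarrow> bool" where
  "exactly_max_modulus_roots k f \<longleftrightarrow>
     (\<exists>rs. mset rs = proots f \<and>
           sorted_wrt (\<lambda>x y. cmod x \<ge> cmod y) rs \<and>
           1 \<le> k \<and> k \<le> length rs \<and>
           (\<forall>i<k. cmod (rs ! i) = cmod (rs ! 0)) \<and>
           (k = length rs \<or> cmod (rs ! (k - 1)) > cmod (rs ! k)))"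

definition A_star_set :: "nat \<Rightarrow> nat \<Rightarrow> nat \<Rightarrow> int poly set" where
  "A_star_set n k H =
     {f. degree f = n \<and> f \<noteq> 0 \<and> height f \<le> int H \<and>
         exactly_max_modulus_roots k (map_poly of_int f)}"

definition A_star :: "nat \<Rightarrow> nat \<Rightarrow> nat \<Rightarrow> nat" where
  "A_star n k H = card (A_star_set n k H)"

lemma height_le_iff: "height f \<le> B \<longleftrightarrow> (\<forall>j\<le>degree f. \<bar>coeff f j\<bar> \<le> B)"
  unfolding height_def by (subst Max_le_iff) auto

lemma finite_A_star_set: "finite (A_star_set n k H)"
proof (rule finite_subset)
  show "A_star_set n k H \<subseteq> Poly ` {xs. set xs \<subseteq> {- int H..int H} \<and> length xs = Suc n}"
  proof
    fix f assume f: "f \<in> A_star_set n k H"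
    have "f = Poly (coeffs f)" by simp
    moreover have "length (coeffs f) = Suc n"
      using f by (simp add: A_star_set_def length_coeffs)
    moreover have "set (coeffs f) \<subseteq> {- int H..int H}"
    proof
      fix a assume "a \<in> set (coeffs f)"
      moreover have "f \<noteq> 0" "\<forall>j\<le>degree f. \<bar>coeff f j\<bar> \<le> int H"
        using f by (simp_all add: A_star_set_def height_le_iff)
      ultimately have "\<bar>a\<bar> \<le> int H"
        by (auto simp: coeffs_def simp del: upt_Suc)
      then show "a \<in> {- int H..int H}" by (simp add: abs_le_iff)
    qed
    ultimately show "f \<in> Poly ` {xs. set xs \<subseteq> {- int H..int H} \<and> length xs = Suc n}"
      by blast
  qed
  show "finite (Poly ` {xs. set xs \<subseteq> {- int H..int H} \<and> length xs = Suc n})"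
    by (intro finite_imageI finite_lists_length_eq) simp
qed

end

theory Submission
  imports Defs "HOL-Library.FuncSet"
begin

text \<open>
  If at least three roots of a real polynomial have maximal modulus, then, since roots come in
  conjugate pairs, there are roots with \<open>\<alpha> \<beta> = \<gamma>\<^sup>2\<close> or with \<open>\<alpha> \<beta> = \<gamma> \<delta>\<close> (counted with
  multiplicity). So the polynomial is \<open>(X\<^sup>2 + b X + s\<^sup>2) (X + s) w\<close> or
  \<open>(X\<^sup>2 + b X + r) (X\<^sup>2 + c X + r) w\<close>. Both shapes have only \<open>n\<close> free complex parameters, and the
  \<open>n + 1\<close> coefficients are polynomials in these, hence satisfy a fixed nontrivial polynomial
  relation. By the Schwartz-Zippel bound such a relation has \<open>O(H\<^sup>n)\<close> solutions in the box of
  coefficient vectors of height at most \<open>H\<close>.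
\<close>

section \<open>Linear algebra: homogeneous systems with more unknowns than equations\<close>

text \<open>Gaussian elimination, by induction on the set \<open>J\<close> of equations: a pivot
  \<open>p\<close> removes one equation together with one unknown, so the strict inequality of
  cardinalities survives.\<close>

lemma underdetermined_system_has_solution:
  fixes A :: "'i \<Rightarrow> 'j \<Rightarrow> 'a::field"
  assumes "finite J" "finite I" "card J < card I"
  shows "\<exists>c. (\<exists>i\<in>I. c i \<noteq> 0) \<and> (\<forall>j\<in>J. (\<Sum>i\<in>I. c i * A i j) = 0)"
  using assms
proof (induction J arbitrary: I A rule: finite_induct)
  case empty
  then have "I \<noteq> {}" by auto
  then show ?case by (intro exI[of _ "\<lambda>_. 1"]) auto
next
  case (insert j J)
  show ?case
  proof (cases "\<forall>i\<in>I. A i j = 0")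
    case True
    moreover have "card J < card I" using insert by simp
    ultimately show ?thesis using insert.IH[of I A] insert.prems by auto
  next
    case False
    then obtain p where p: "p \<in> I" "A p j \<noteq> 0" by blast
    define I' where "I' = I - {p}"
    have I: "I = insert p I'" "p \<notin> I'" "finite I'" using p insert.prems by (auto simp: I'_def)
    have "card J < card I'" using insert I by simp
    \<comment> \<open>The new matrix subtracts from each row the multiple of row \<open>p\<close>
      that clears column \<open>j\<close>.\<close>
    from insert.IH[OF \<open>finite I'\<close> this, of "\<lambda>i j'. A i j' - A i j / A p j * A p j'"]
    obtain c where c: "\<exists>i\<in>I'. c i \<noteq> 0"
      "\<And>j'. j' \<in> J \<Longrightarrow> (\<Sum>i\<in>I'. c i * (A i j' - A i j / A p j * A p j')) = 0" by blast
    define s where "s = (\<Sum>i\<in>I'. c i * A i j)"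
    \<comment> \<open>The value at \<open>p\<close> is the only one for which equation
      \<open>j\<close> holds.\<close>
    define d where "d = c(p := - s / A p j)"
    have d: "(\<Sum>i\<in>I. d i * A i j') = (\<Sum>i\<in>I'. c i * A i j') - s / A p j * A p j'" for j'
    proof -
      have "(\<Sum>i\<in>I'. d i * A i j') = (\<Sum>i\<in>I'. c i * A i j')"
        using I by (intro sum.cong) (auto simp: d_def)
      then show ?thesis using I by (simp add: d_def)
    qed
    have "(\<Sum>i\<in>I. d i * A i j') = 0" if "j' \<in> insert j J" for j'
    proof (cases "j' = j")
      case True
      then show ?thesis using p d[of j] by (simp add: s_def)
    next
      case False
      then have "(\<Sum>i\<in>I'. c i * (A i j' - A i j / A p j * A p j')) = 0" using that c by auto
      also have "(\<Sum>i\<in>I'. c i * (A i j' - A i j / A p j * A p j'))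
          = (\<Sum>i\<in>I'. c i * A i j' - c i * A i j * (A p j' / A p j))"
        by (intro sum.cong) (simp_all add: right_diff_distrib)
      also have "\<dots> = (\<Sum>i\<in>I'. c i * A i j') - s / A p j * A p j'"
        by (simp add: sum_subtractf s_def sum_distrib_right sum_divide_distrib)
      finally show ?thesis using d by simp
    qed
    moreover have "\<exists>i\<in>I. d i \<noteq> 0" using c(1) I by (auto simp: d_def)
    ultimately show ?thesis by blast
  qed
qed

section \<open>Monomials in several variables and the Schwartz-Zippel bound\<close>

text \<open>The bound \<open>D\<close> applies to each exponent separately rather than to the total
  degree, which makes the number of monomials an exact power. Extensional functions make each
  exponent vector occur once.\<close>

definition multi_exps :: "nat \<Rightarrow> nat \<Rightarrow> (nat \<Rightarrow> nat) set" where
  "multi_exps m D = {..<m} \<rightarrow>\<^sub>E {..D}"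

definition mono_fun :: "nat \<Rightarrow> (nat \<Rightarrow> nat) \<Rightarrow> (nat \<Rightarrow> 'a::comm_ring_1) \<Rightarrow> 'a" where
  "mono_fun m e x = (\<Prod>i<m. x i ^ e i)"

lemma finite_multi_exps [simp]: "finite (multi_exps m D)"
  by (auto simp: multi_exps_def intro: finite_PiE)

lemma card_multi_exps: "card (multi_exps m D) = Suc D ^ m"
  by (simp add: multi_exps_def card_PiE)

text \<open>Splits off the last coordinate. It serves below both for exponent vectors and for points
  of the grid.\<close>

lemma sum_PiE_lessThan_Suc:
  assumes "finite A"
  shows "sum g ({..<Suc m} \<rightarrow>\<^sub>E A) = (\<Sum>k\<in>A. \<Sum>e\<in>{..<m} \<rightarrow>\<^sub>E A. g (e(m := k)))"
proof -
  have "sum g ({..<Suc m} \<rightarrow>\<^sub>E A) = sum g ((\<lambda>(y, e). e(m := y)) ` (A \<times> ({..<m} \<rightarrow>\<^sub>E A)))"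
    by (simp add: lessThan_Suc PiE_insert_eq)
  also have "\<dots> = (\<Sum>(y, e)\<in>A \<times> ({..<m} \<rightarrow>\<^sub>E A). g (e(m := y)))"
    by (subst sum.reindex[OF inj_combinator]) (auto intro!: sum.cong)
  also have "\<dots> = (\<Sum>k\<in>A. \<Sum>e\<in>{..<m} \<rightarrow>\<^sub>E A. g (e(m := k)))"
    by (simp add: sum.cartesian_product)
  finally show ?thesis .
qed

lemma mono_fun_Suc_upd:
  "mono_fun (Suc m) (e(m := k)) (y(m := s)) = mono_fun m e y * s ^ k"
proof -
  have "(\<Prod>i<m. (y(m := s)) i ^ (e(m := k)) i) = (\<Prod>i<m. y i ^ e i)"
    by (intro prod.cong) auto
  then show ?thesis by (simp add: mono_fun_def)
qed

lemma card_zeros_univariate_le: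
  fixes a :: "nat \<Rightarrow> 'a::idom"
  assumes "k0 \<le> N" "a k0 \<noteq> 0"
  shows "card {s\<in>S. (\<Sum>k\<le>N. a k * s ^ k) = 0} \<le> N"
proof -
  define p where "p = (\<Sum>k\<le>N. monom (a k) k)"
  have "coeff p k0 = a k0"
    using assms by (simp add: p_def coeff_sum sum.delta)
  then have "p \<noteq> 0" using assms by auto
  have "degree p \<le> N" unfolding p_def
    by (intro degree_sum_le) (auto intro: order_trans[OF degree_monom_le])
  have "{s\<in>S. (\<Sum>k\<le>N. a k * s ^ k) = 0} \<subseteq> {s. poly p s = 0}"
    by (auto simp: p_def poly_sum poly_monom)
  then have "card {s\<in>S. (\<Sum>k\<le>N. a k * s ^ k) = 0} \<le> card {s. poly p s = 0}"
    using poly_roots_finite[OF \<open>p \<noteq> 0\<close>] by (intro card_mono) auto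
  also have "\<dots> \<le> degree p" using \<open>p \<noteq> 0\<close> by (rule card_poly_roots_bound)
  finally show ?thesis using \<open>degree p \<le> N\<close> by simp
qed

text \<open>Induction on the number of variables, reading the polynomial as one in the last
  variable. Over a point \<open>y\<close> of the smaller grid, either a chosen coefficient vanishes,
  which is rare by induction, or at most \<open>N\<close> values of the last variable are zeros. The
  factor \<open>card S\<close> on the left avoids the exponent \<open>m - 1\<close>.\<close>

lemma schwartz_zippel:
  fixes c :: "(nat \<Rightarrow> nat) \<Rightarrow> 'a::idom"
  assumes S: "finite S" and "\<exists>e\<in>multi_exps m N. c e \<noteq> 0"
  shows "card {x \<in> {..<m} \<rightarrow>\<^sub>E S. (\<Sum>e\<in>multi_exps m N. c e * mono_fun m e x) = 0} * card S
           \<le> m * N * card S ^ m"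
  using assms(2)
proof (induction m arbitrary: c)
  case 0
  \<comment> \<open>Without variables the only monomial is the empty product 1, so the sum is a
    nonzero constant.\<close>
  have "multi_exps 0 N = {\<lambda>_. undefined}" by (simp add: multi_exps_def)
  with 0 have "{x \<in> {..<0} \<rightarrow>\<^sub>E S. (\<Sum>e\<in>multi_exps 0 N. c e * mono_fun 0 e x) = 0} = {}"
    by (simp add: mono_fun_def)
  then show ?case by (simp only: card.empty mult_0)
next
  case (Suc m)
  define Q where "Q = (\<lambda>k y. \<Sum>e\<in>multi_exps m N. c (e(m := k)) * mono_fun m e y)"
  obtain e where e: "e \<in> multi_exps (Suc m) N" "c e \<noteq> 0" using Suc.prems by blast
  \<comment> \<open>Taking \<open>k0\<close> from a monomial that really occurs makes the
    coefficient \<open>Q k0\<close> nontrivial, as the induction hypothesis requires.\<close>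
  define k0 where "k0 = e m"
  have e_le: "e i \<le> N" if "i < Suc m" for i
    using PiE_mem[OF e(1)[unfolded multi_exps_def], of i] that by simp
  then have k0: "k0 \<le> N" by (simp add: k0_def)
  have "restrict e {..<m} \<in> multi_exps m N"
    unfolding multi_exps_def by (intro restrict_PiE_iff[THEN iffD2] ballI) (simp add: e_le)
  moreover have "(restrict e {..<m})(m := k0) = e"
  proof
    fix i
    have "e i = undefined" if "\<not> i < Suc m"
      using PiE_arb[OF e(1)[unfolded multi_exps_def], of i] that by simp
    then show "((restrict e {..<m})(m := k0)) i = e i" by (auto simp: k0_def)
  qed
  ultimately have "\<exists>e'\<in>multi_exps m N. c (e'(m := k0)) \<noteq> 0"
    using e(2) by (intro bexI[of _ "restrict e {..<m}"]) simp_all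
  from Suc.IH[OF this] have IH:
    "card {y \<in> {..<m} \<rightarrow>\<^sub>E S. Q k0 y = 0} * card S \<le> m * N * card S ^ m"
    by (simp only: Q_def)
  define P where "P = (\<lambda>x. (\<Sum>e\<in>multi_exps (Suc m) N. c e * mono_fun (Suc m) e x) = 0)"
  have P: "P (y(m := s)) \<longleftrightarrow> (\<Sum>k\<le>N. Q k y * s ^ k) = 0" for y s
    unfolding P_def multi_exps_def Q_def
    by (subst sum_PiE_lessThan_Suc) (simp_all add: mono_fun_Suc_upd sum_distrib_right mult.assoc)
  have fin: "finite ({..<m} \<rightarrow>\<^sub>E S)" "finite ({..<Suc m} \<rightarrow>\<^sub>E S)" for m
    using S by (auto intro: finite_PiE)
  have "card {x \<in> {..<Suc m} \<rightarrow>\<^sub>E S. P x} = (\<Sum>x\<in>{..<Suc m} \<rightarrow>\<^sub>E S. if P x then 1 else 0)"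
    using fin by (simp add: sum.If_cases Int_def)
  also have "\<dots> = (\<Sum>y\<in>{..<m} \<rightarrow>\<^sub>E S. \<Sum>s\<in>S. if P (y(m := s)) then 1 else 0)"
    by (subst sum_PiE_lessThan_Suc[OF S], subst sum.swap) simp
  also have "\<dots> = (\<Sum>y\<in>{..<m} \<rightarrow>\<^sub>E S. card {s\<in>S. P (y(m := s))})"
    using S by (simp add: sum.If_cases Int_def)
  \<comment> \<open>Fibrewise bound: the trivial \<open>card S\<close> where \<open>Q k0\<close>
    vanishes, the univariate bound \<open>N\<close> elsewhere.\<close>
  also have "\<dots> \<le> (\<Sum>y\<in>{..<m} \<rightarrow>\<^sub>E S. N + (if Q k0 y = 0 then card S else 0))"
  proof (rule sum_mono)
    fix y
    show "card {s\<in>S. P (y(m := s))} \<le> N + (if Q k0 y = 0 then card S else 0)"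
    proof (cases "Q k0 y = 0")
      case True
      then show ?thesis using card_mono[OF S, of "{s\<in>S. P (y(m := s))}"] by auto
    next
      case False
      then show ?thesis using card_zeros_univariate_le[of k0 N "\<lambda>k. Q k y" S] k0 by (simp add: P)
    qed
  qed
  also have "\<dots> = N * card S ^ m + card {y \<in> {..<m} \<rightarrow>\<^sub>E S. Q k0 y = 0} * card S"
    using fin by (simp add: sum.distrib sum.If_cases Int_def card_PiE)
  also have "\<dots> \<le> N * card S ^ m + m * N * card S ^ m"
    using IH by simp
  also have "\<dots> = Suc m * N * card S ^ m" by (simp add: distrib_right)
  finally have "card {x \<in> {..<Suc m} \<rightarrow>\<^sub>E S. P x} \<le> Suc m * N * card S ^ m" .
  then have "card {x \<in> {..<Suc m} \<rightarrow>\<^sub>E S. P x} * card S \<le> (Suc m * N * card S ^ m) * card S"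
    by (rule mult_right_mono) simp
  then show ?case by (simp add: P_def mult_ac)
qed

section \<open>Polynomial functions and algebraic dependence\<close>

text \<open>Polynomials in \<open>m\<close> variables are represented as functions, with degree at
  most \<open>D\<close> in each variable; closure properties then follow by induction on sums of
  monomials.\<close>

inductive polyfun :: "nat \<Rightarrow> nat \<Rightarrow> ((nat \<Rightarrow> 'a::field) \<Rightarrow> 'a) \<Rightarrow> bool" for m D where
  mono: "(\<And>i. i < m \<Longrightarrow> e i \<le> D) \<Longrightarrow> polyfun m D (\<lambda>x. c * mono_fun m e x)"
| add: "polyfun m D F \<Longrightarrow> polyfun m D G \<Longrightarrow> polyfun m D (\<lambda>x. F x + G x)"

lemma polyfun_const: "polyfun m D (\<lambda>x. c)"
  using polyfun.mono[of m "\<lambda>_. 0" D c] by (simp add: mono_fun_def)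

lemma polyfun_var:
  assumes "i < m" "1 \<le> D"
  shows "polyfun m D (\<lambda>x. x i)"
proof -
  have "mono_fun m (\<lambda>j. if j = i then 1 else 0) x = (x i :: 'a)" for x
  proof -
    have "mono_fun m (\<lambda>j. if j = i then 1 else 0) x = (\<Prod>j<m. if j = i then x j else 1)"
      unfolding mono_fun_def by (intro prod.cong) auto
    also have "\<dots> = x i" using assms by simp
    finally show ?thesis .
  qed
  then show ?thesis
    using polyfun.mono[of m "\<lambda>j. if j = i then 1 else 0" D "1 :: 'a"] assms by simp
qed

lemma polyfun_le:
  assumes "polyfun m D F" "D \<le> E"
  shows "polyfun m E F"
  using assms(1)
  by induction (use assms(2) in \<open>auto intro!: polyfun.intros intro: order_trans\<close>)

lemma polyfun_mult:
  assumes "polyfun m D F" "polyfun m E G"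
  shows "polyfun m (D + E) (\<lambda>x. F x * G x)"
  using assms(1)
proof induction
  case (mono e c)
  show ?case using assms(2)
  proof induction
    case (mono e' c')
    have "c * mono_fun m e x * (c' * mono_fun m e' x) = c * c' * mono_fun m (\<lambda>i. e i + e' i) x" for x
      by (simp add: mono_fun_def power_add prod.distrib)
    moreover have "polyfun m (D + E) (\<lambda>x. c * c' * mono_fun m (\<lambda>i. e i + e' i) x)"
      by (intro polyfun.mono add_mono mono \<open>\<And>i. i < m \<Longrightarrow> e i \<le> D\<close>)
    ultimately show ?case by (simp only:)
  qed (auto simp: distrib_left intro: polyfun.add)
qed (auto simp: distrib_right intro: polyfun.add)

lemma polyfun_sum:
  assumes "finite I" "\<And>i. i \<in> I \<Longrightarrow> polyfun m D (F i)"
  shows "polyfun m D (\<lambda>x. \<Sum>i\<in>I. F i x)"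
  using assms by induction (auto intro: polyfun.add polyfun_const)

lemma polyfun_power: "polyfun m D F \<Longrightarrow> polyfun m (k * D) (\<lambda>x. F x ^ k)"
  by (induction k) (auto intro: polyfun_mult polyfun_const)

lemma polyfun_prod:
  fixes k :: nat
  assumes "\<And>i. i < k \<Longrightarrow> polyfun m D (F i)"
  shows "polyfun m (k * D) (\<lambda>x. \<Prod>i<k. F i x)"
  using assms
proof (induction k)
  case (Suc k)
  then have "polyfun m (k * D + D) (\<lambda>x. (\<Prod>i<k. F i x) * F k x)"
    by (intro polyfun_mult) auto
  then show ?case by (simp add: add.commute)
qed (auto intro: polyfun_const)

lemma polyfun_normal_form:
  assumes "polyfun m D F"
  obtains c where "\<And>x. F x = (\<Sum>e\<in>multi_exps m D. c e * mono_fun m e x)"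
proof -
  have "\<exists>c. \<forall>x. F x = (\<Sum>e\<in>multi_exps m D. c e * mono_fun m e x)" using assms
  proof induction
    case (mono e c)
    \<comment> \<open>The exponents of a generator are arbitrary outside \<open>{..<m}\<close>;
      restriction picks the representative in \<open>multi_exps m D\<close>.\<close>
    let ?e = "restrict e {..<m}"
    have "?e \<in> multi_exps m D" using mono by (auto simp: multi_exps_def)
    moreover have "mono_fun m ?e x = mono_fun m e x" for x :: "nat \<Rightarrow> 'a"
      by (simp add: mono_fun_def)
    moreover have "(\<Sum>e'\<in>multi_exps m D. (if e' = ?e then c else 0) * mono_fun m e' x)
        = (\<Sum>e'\<in>multi_exps m D. if e' = ?e then c * mono_fun m e' x else 0)" for x
      by (intro sum.cong) auto
    ultimately show ?case
      by (intro exI[of _ "\<lambda>e'. if e' = ?e then c else 0"]) simp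
  next
    case (add F G)
    then obtain c d where
      "\<forall>x. F x = (\<Sum>e\<in>multi_exps m D. c e * mono_fun m e x)"
      "\<forall>x. G x = (\<Sum>e\<in>multi_exps m D. d e * mono_fun m e x)" by blast
    then show ?case
      by (intro exI[of _ "\<lambda>e. c e + d e"]) (simp add: sum.distrib distrib_right)
  qed
  then show ?thesis using that by blast
qed

lemma polyfuns_algebraically_dependent:
  assumes F: "\<And>l. l < M \<Longrightarrow> polyfun m D (F l)" and "m < M"
  obtains N c where "\<exists>e\<in>multi_exps M N. c e \<noteq> 0"
    "\<And>x. (\<Sum>e\<in>multi_exps M N. c e * mono_fun M e (\<lambda>l. F l x)) = 0"
proof -
  \<comment> \<open>The \<open>(N + 1) ^ M\<close> monomials in \<open>F\<close> lie in a space of dimension \<open>(M N D + 1) ^ m\<close>;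
      as \<open>m < M\<close>, this \<open>N\<close> makes the first number the larger one.\<close>
  define N where "N = (M * D + 1) ^ m"
  define E where "E = M * (N * D)"
  have "polyfun m E (\<lambda>x. mono_fun M e (\<lambda>l. F l x))" if "e \<in> multi_exps M N" for e
    unfolding E_def mono_fun_def
  proof (rule polyfun_prod)
    fix l assume "l < M"
    then have "e l * D \<le> N * D" using that by (auto simp: multi_exps_def)
    then show "polyfun m (N * D) (\<lambda>x. F l x ^ e l)"
      using polyfun_le polyfun_power[OF F[OF \<open>l < M\<close>]] by blast
  qed
  then have "\<forall>e\<in>multi_exps M N. \<exists>a. \<forall>x.
      mono_fun M e (\<lambda>l. F l x) = (\<Sum>j\<in>multi_exps m E. a j * mono_fun m j x)"
    by (metis polyfun_normal_form)
  then obtain A where A: "\<And>e x. e \<in> multi_exps M N \<Longrightarrow>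
      mono_fun M e (\<lambda>l. F l x) = (\<Sum>j\<in>multi_exps m E. A e j * mono_fun m j x)"
    by metis
  have "card (multi_exps m E) < card (multi_exps M N)"
  proof -
    have "Suc E \<le> (M * D + 1) * (N + 1)" by (simp add: E_def algebra_simps)
    then have "Suc E ^ m \<le> (M * D + 1) ^ m * (N + 1) ^ m"
      by (metis power_mono power_mult_distrib le0)
    also have "\<dots> < (N + 1) * (N + 1) ^ m" by (simp add: N_def)
    also have "\<dots> = Suc N ^ Suc m" by simp
    also have "\<dots> \<le> Suc N ^ M" using \<open>m < M\<close> by (intro power_increasing) auto
    finally show ?thesis by (simp add: card_multi_exps)
  qed
  \<comment> \<open>The rows \<open>A e\<close> are coefficient vectors of the substituted
    monomials; there are more of them than coordinates, so they are linearly dependent.\<close>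
  then have "\<exists>c. (\<exists>e\<in>multi_exps M N. c e \<noteq> 0) \<and>
      (\<forall>j\<in>multi_exps m E. (\<Sum>e\<in>multi_exps M N. c e * A e j) = 0)"
    by (intro underdetermined_system_has_solution) simp_all
  then obtain c where c: "\<exists>e\<in>multi_exps M N. c e \<noteq> 0"
    "\<forall>j\<in>multi_exps m E. (\<Sum>e\<in>multi_exps M N. c e * A e j) = 0" by (elim exE conjE)
  have "(\<Sum>e\<in>multi_exps M N. c e * mono_fun M e (\<lambda>l. F l x)) = 0" for x
  proof -
    have "(\<Sum>e\<in>multi_exps M N. c e * mono_fun M e (\<lambda>l. F l x))
        = (\<Sum>e\<in>multi_exps M N. \<Sum>j\<in>multi_exps m E. c e * A e j * mono_fun m j x)"
      by (simp add: A sum_distrib_left mult.assoc)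
    also have "\<dots> = (\<Sum>j\<in>multi_exps m E. (\<Sum>e\<in>multi_exps M N. c e * A e j) * mono_fun m j x)"
      by (subst sum.swap) (simp add: sum_distrib_right)
    finally show ?thesis using c(2) by simp
  qed
  then show ?thesis by (rule that[OF c(1)])
qed

section \<open>Counting integer polynomials in a family with \<open>n\<close> parameters\<close>

definition polyfun_family :: "nat \<Rightarrow> nat \<Rightarrow> ((nat \<Rightarrow> 'a::field) \<Rightarrow> 'a poly) \<Rightarrow> bool" where
  "polyfun_family m D G \<longleftrightarrow> (\<forall>l. polyfun m D (\<lambda>x. coeff (G x) l))"

lemma polyfun_family_mult:
  assumes "polyfun_family m D F" "polyfun_family m E G"
  shows "polyfun_family m (D + E) (\<lambda>x. F x * G x)"
  using assms by (auto simp: polyfun_family_def coeff_mult intro!: polyfun_sum polyfun_mult)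

lemma polyfun_family_0: "polyfun_family m D (\<lambda>x. 0)"
  by (auto simp: polyfun_family_def intro: polyfun_const)

lemma polyfun_family_pCons:
  assumes "polyfun m D a" "polyfun_family m D G"
  shows "polyfun_family m D (\<lambda>x. pCons (a x) (G x))"
  unfolding polyfun_family_def
proof
  fix l
  show "polyfun m D (\<lambda>x. coeff (pCons (a x) (G x)) l)"
    using assms by (cases l) (auto simp: polyfun_family_def)
qed

lemma polyfun_family_Poly:
  assumes "\<And>i. i < k \<Longrightarrow> polyfun m D (a i)"
  shows "polyfun_family m D (\<lambda>x. Poly (map (\<lambda>i. a i x) [0..<k]))"
  unfolding polyfun_family_def
proof
  fix l
  show "polyfun m D (\<lambda>x. coeff (Poly (map (\<lambda>i. a i x) [0..<k])) l)"
    using assms by (cases "l < k") (auto simp: nth_default_def intro: polyfun_const)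
qed

definition polys_of_height :: "nat \<Rightarrow> nat \<Rightarrow> int poly set" where
  "polys_of_height n H = {f. degree f = n \<and> height f \<le> int H}"

text \<open>The \<open>n + 1\<close> coefficients depend on \<open>n\<close> parameters, so they
  satisfy a nontrivial relation. It is fixed before \<open>H\<close> is chosen, hence
  \<open>C\<close> does not depend on \<open>H\<close>. Finiteness is recorded because
  \<open>card\<close> is 0 on infinite sets.\<close>

lemma card_polys_in_family_le:
  fixes G :: "(nat \<Rightarrow> 'a::field_char_0) \<Rightarrow> 'a poly"
  assumes "polyfun_family n D G"
  obtains C :: nat where
    "\<And>H. H \<ge> 1 \<Longrightarrow> finite {f \<in> polys_of_height n H. map_poly of_int f \<in> range G}"
    "\<And>H. H \<ge> 1 \<Longrightarrow> card {f \<in> polys_of_height n H. map_poly of_int f \<in> range G} \<le> C * H ^ n"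
proof -
  have "polyfun n D (\<lambda>x. coeff (G x) l)" for l using assms by (simp add: polyfun_family_def)
  from polyfuns_algebraically_dependent[of "Suc n" n D "\<lambda>l x. coeff (G x) l", OF this]
  obtain N c where c: "\<exists>e\<in>multi_exps (Suc n) N. c e \<noteq> 0"
    "\<And>x. (\<Sum>e\<in>multi_exps (Suc n) N. c e * mono_fun (Suc n) e (coeff (G x))) = 0"
    by auto
  define C where "C = Suc n * N * 3 ^ n"
  have "finite {f \<in> polys_of_height n H. map_poly of_int f \<in> range G} \<and>
      card {f \<in> polys_of_height n H. map_poly of_int f \<in> range G} \<le> C * H ^ n" if "H \<ge> 1" for H
  proof -
    let ?B = "{f \<in> polys_of_height n H. map_poly of_int f \<in> range G}"
    define S where "S = (of_int :: int \<Rightarrow> 'a) ` {- int H..int H}"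
    have S: "finite S" "card S = 2 * H + 1" by (auto simp: S_def card_image inj_on_def)
    define Z where "Z = {x \<in> {..<Suc n} \<rightarrow>\<^sub>E S.
        (\<Sum>e\<in>multi_exps (Suc n) N. c e * mono_fun (Suc n) e x) = 0}"
    have "finite Z" unfolding Z_def using S(1) by (simp add: finite_PiE)
    \<comment> \<open>Coefficient vectors embed the polynomials into the zero set on the grid;
      injectivity uses that coefficients beyond \<open>n\<close> vanish.\<close>
    define r where "r = (\<lambda>f. restrict (\<lambda>l. of_int (coeff f l) :: 'a) {..<Suc n})"
    have inj: "inj_on r ?B"
    proof (rule inj_onI)
      fix f g assume fg: "f \<in> ?B" "g \<in> ?B" "r f = r g"
      show "f = g"
      proof (rule poly_eqI)
        fix l
        show "coeff f l = coeff g l"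
        proof (cases "l < Suc n")
          case True
          then show ?thesis using fun_cong[OF fg(3), of l] by (simp add: r_def)
        next
          case False
          then show ?thesis using fg by (simp add: polys_of_height_def coeff_eq_0)
        qed
      qed
    qed
    have sub: "r ` ?B \<subseteq> Z"
    proof
      fix y assume "y \<in> r ` ?B"
      then obtain f x where f: "f \<in> polys_of_height n H" "map_poly of_int f = G x" "y = r f"
        by auto
      have "coeff (G x) l = of_int (coeff f l)" for l
        using f(2) by (metis coeff_map_poly of_int_0)
      then have "mono_fun (Suc n) e y = mono_fun (Suc n) e (coeff (G x))" for e
        unfolding mono_fun_def f(3) r_def by (intro prod.cong) auto
      then have "(\<Sum>e\<in>multi_exps (Suc n) N. c e * mono_fun (Suc n) e y) = 0"
        using c(2)[of x] by simp
      moreover have "y \<in> {..<Suc n} \<rightarrow>\<^sub>E S"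
        using f(1) by (auto simp: f(3) r_def S_def polys_of_height_def height_le_iff abs_le_iff)
          (metis abs_le_iff atLeastAtMost_iff imageI less_Suc_eq_le minus_le_iff)
      ultimately show "y \<in> Z" by (simp add: Z_def)
    qed
    have "finite ?B" using finite_imageD[OF finite_subset[OF sub \<open>finite Z\<close>] inj] .
    have "card ?B \<le> card Z" using card_inj_on_le[OF inj sub \<open>finite Z\<close>] .
    also have "card Z \<le> Suc n * N * card S ^ n"
    proof -
      have "card Z * card S \<le> Suc n * N * card S ^ n * card S"
        using schwartz_zippel[OF S(1) c(1)] by (simp add: Z_def mult_ac)
      then show ?thesis using S(2) by (subst (asm) mult_le_cancel2) simp
    qed
    \<comment> \<open>For \<open>H \<ge> 1\<close> the grid side \<open>2 * H + 1\<close> is at most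
      \<open>3 * H\<close>.\<close>
    also have "\<dots> \<le> Suc n * N * (3 * H) ^ n"
      using that by (intro mult_left_mono power_mono) (auto simp: S(2))
    also have "\<dots> = C * H ^ n" by (simp add: C_def power_mult_distrib mult_ac)
    finally show ?thesis using \<open>finite ?B\<close> by blast
  qed
  then show ?thesis using that by blast
qed

section \<open>Root multisets and complex conjugation\<close>

lemma proots_cofactor:
  fixes f :: "'a::idom poly"
  assumes "f \<noteq> 0" "A \<subseteq># proots f"
  obtains w where "f = (\<Prod>x\<in>#A. [:-x, 1:]) * w" "degree f = size A + degree w"
proof -
  \<comment> \<open>The third conjunct strengthens the induction: it locates the next element of
    \<open>A\<close> among the roots of the cofactor.\<close>
  have "\<exists>w. f = (\<Prod>x\<in>#A. [:-x, 1:]) * w \<and> degree f = size A + degree w \<and>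
      proots f = A + proots w" using assms(2)
  proof (induction A)
    case (add x A)
    have "A \<subseteq># proots f" using add.prems by (rule mset_subset_eq_insertD[THEN conjunct2, THEN subset_mset.less_imp_le])
    then obtain w where w: "f = (\<Prod>x\<in>#A. [:-x, 1:]) * w" "degree f = size A + degree w"
        "proots f = A + proots w"
      using add.IH by blast
    have "w \<noteq> 0" using w(1) assms(1) by auto
    have "A + {#x#} \<subseteq># A + proots w" using add.prems w(3) by simp
    then have "x \<in># proots w" by (simp only: subset_mset.add_le_cancel_left single_subset_iff)
    then have "poly w x = 0" using \<open>w \<noteq> 0\<close> by simp
    then obtain v where v: "w = [:-x, 1:] * v" by (auto simp: poly_eq_0_iff_dvd)
    then have "v \<noteq> 0" using \<open>w \<noteq> 0\<close> by auto
    have "degree w = Suc (degree v)" unfolding v using \<open>v \<noteq> 0\<close> by (subst degree_mult_eq) auto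
    moreover have "proots w = add_mset x (proots v)"
      unfolding v using \<open>v \<noteq> 0\<close> by (subst proots_mult) auto
    moreover have "(\<Prod>x\<in>#A. [:-x, 1:]) * w = (\<Prod>x\<in>#add_mset x A. [:-x, 1:]) * v"
      unfolding v image_mset_add_mset prod_mset.add_mset by (simp only: mult_ac)
    ultimately show ?case using w by (intro exI[of _ v]) simp
  qed auto
  then show ?thesis using that by blast
qed

text \<open>Conjugating the factorization of \<open>f\<close> into linear factors gives another
  factorization of \<open>f\<close>, whose root multiset is the conjugate one.\<close>

lemma image_mset_cnj_proots:
  assumes "\<And>i. cnj (coeff f i) = coeff f i"
  shows "image_mset cnj (proots f) = proots f"
proof (cases "f = 0")
  case False
  let ?M = "proots f"
  have "map_poly cnj f = f" using assms by (intro poly_eqI) (simp add: coeff_map_poly)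
  have "f = smult (cnj (lead_coeff f)) (\<Prod>x\<in>#image_mset cnj ?M. [:-x, 1:])" (is "_ = ?g")
  proof (rule poly_ext)
    fix x
    have "poly f x = cnj (poly f (cnj x))"
      using poly_map_poly_cnj[of f x] \<open>map_poly cnj f = f\<close> by simp
    also have "poly f (cnj x) = lead_coeff f * (\<Prod>a\<in>#?M. cnj x - a)"
      by (subst complex_poly_decompose_multiset[of f, symmetric])
        (simp add: poly_prod_mset multiset.map_comp o_def)
    also have "cnj \<dots> = cnj (lead_coeff f) * (\<Prod>a\<in>#?M. x - cnj a)"
    proof -
      have "cnj (\<Prod>a\<in>#M. cnj x - a) = (\<Prod>a\<in>#M. x - cnj a)" for M
        by (induction M) auto
      then show ?thesis by simp
    qed
    also have "\<dots> = poly ?g x"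
      by (simp add: poly_prod_mset multiset.map_comp o_def)
    finally show "poly f x = poly ?g x" .
  qed
  then have "?M = proots ?g" by (rule arg_cong)
  also have "\<dots> = proots (\<Prod>x\<in>#image_mset cnj ?M. [:-x, 1:])"
    using False by (intro proots_smult) simp
  also have "\<dots> = image_mset cnj ?M"
  proof -
    have "proots (\<Prod>x\<in>#M. [:-x, 1:]) = M" for M :: "complex multiset"
    proof (induction M)
      case (add x M)
      have "(\<Prod>x\<in>#M. [:-x, 1:]) \<noteq> 0" by (auto simp: prod_mset_zero_iff)
      then show ?case using add by (simp add: proots_mult del: mult_pCons_left)
    qed simp
    then show ?thesis .
  qed
  finally show ?thesis by simp
qed simp

lemma cnj_pair_subset:
  assumes "image_mset cnj M = M" "z \<in># M" "z \<noteq> cnj z"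
  shows "{#z, cnj z#} \<subseteq># M"
proof -
  have "cnj z \<in># M" using assms by (metis image_eqI set_image_mset)
  then have "cnj z \<in># M - {#z#}" using assms(3) by (simp add: in_diff_count)
  then show ?thesis using assms(2) by (simp add: insert_subset_eq_iff)
qed

text \<open>A nonreal \<open>z\<close> of modulus \<open>r\<close> uses up a conjugate pair with
  product \<open>r\<^sup>2\<close>, and a further root \<open>y\<close> of modulus \<open>r\<close>
  remains: if real, its square is \<open>r\<^sup>2\<close>; if not, it brings its own pair with the
  same product. If all these roots are real, they equal \<open>r\<close> or \<open>-r\<close>, and
  two of any three coincide.\<close>

lemma three_conjugation_closed:
  assumes "image_mset cnj M = M" "3 \<le> size (filter_mset (\<lambda>z. cmod z = r) M)"
  obtains
    (three) \<alpha> \<beta> \<gamma> where "{#\<alpha>, \<beta>, \<gamma>#} \<subseteq># M" "\<alpha> * \<beta> = \<gamma>\<^sup>2"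
  | (four) \<alpha> \<beta> \<gamma> \<delta> where "{#\<alpha>, \<beta>, \<gamma>, \<delta>#} \<subseteq># M" "\<alpha> * \<beta> = \<gamma> * \<delta>"
proof -
  define K where "K = filter_mset (\<lambda>z. cmod z = r) M"
  have KM: "K \<subseteq># M" by (simp add: K_def)
  have norm: "z * cnj z = (complex_of_real r)\<^sup>2" if "z \<in># K" for z
    using that by (simp add: K_def flip: complex_norm_square)
  show thesis
  proof (cases "\<exists>z\<in>#K. z \<noteq> cnj z")
    case True
    then obtain z where z: "z \<in># K" "z \<noteq> cnj z" by blast
    define P where "P = {#z, cnj z#}"
    have P: "P \<subseteq># M" unfolding P_def
      using z KM by (intro cnj_pair_subset assms) (auto dest: mset_subset_eqD)
    have "filter_mset (\<lambda>z. cmod z = r) P = P" using z by (simp add: P_def K_def)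
    then have "filter_mset (\<lambda>z. cmod z = r) (M - P) = K - P" by (simp add: K_def)
    moreover have "size (K - P) \<ge> size K - size P" by (rule diff_size_le_size_Diff)
    ultimately have "filter_mset (\<lambda>z. cmod z = r) (M - P) \<noteq> {#}"
      using assms(2) by (auto simp: P_def K_def)
    then obtain y where "y \<in># filter_mset (\<lambda>z. cmod z = r) (M - P)"
      using multiset_nonemptyE by blast
    then have y: "y \<in># M - P" "cmod y = r" by (auto simp del: filter_diff_mset)
    have y': "y \<in># K" using y by (auto simp: K_def dest: in_diffD)
    have eq: "z * cnj z = y * cnj y" using norm z y' by simp
    show thesis
    proof (cases "y = cnj y")
      case True
      have "P + {#y#} \<subseteq># M"
        using P y(1) by (metis add.commute mset_subset_eq_single subset_mset.le_diff_conv2)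
      then have "{#z, cnj z, y#} \<subseteq># M" by (simp add: P_def add_mset_commute)
      then show thesis using three eq True by (metis power2_eq_square)
    next
      case False
      \<comment> \<open>Removing a conjugate pair keeps the multiset closed under conjugation, so
        the pair of \<open>y\<close> lies in what is left, even when \<open>y\<close> equals
        \<open>z\<close> or \<open>cnj z\<close>.\<close>
      have "image_mset cnj (M - P) = M - P"
        using P assms(1) by (simp add: image_mset_Diff P_def add_mset_commute)
      then have "{#y, cnj y#} \<subseteq># M - P" using y(1) False by (rule cnj_pair_subset)
      then have "P + {#y, cnj y#} \<subseteq># M"
        using P by (metis add.commute subset_mset.le_diff_conv2)
      then have "{#z, cnj z, y, cnj y#} \<subseteq># M" by (simp add: P_def add_mset_commute)
      then show thesis using four eq by blast
    qed
  next
    case False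
    obtain xs where xs: "mset xs = K" using ex_mset by blast
    then have "3 \<le> length xs" using assms(2) by (simp add: K_def flip: size_mset)
    then obtain a b c ys where "xs = a # b # c # ys"
      by (auto simp: numeral_3_eq_3 Suc_le_length_iff)
    then have K: "K = {#a, b, c#} + mset ys" using xs by auto
    then have abc: "{#a, b, c#} \<subseteq># M"
      using KM by (metis mset_subset_eq_add_left subset_mset.order_trans)
    have sq: "x * x = (complex_of_real r)\<^sup>2" if "x \<in># K" for x
      using norm[OF that] False that by metis
    have sqs: "a * a = c\<^sup>2" "b * b = a\<^sup>2" "b * b = c\<^sup>2" "a * a = b\<^sup>2"
      using sq[of a] sq[of b] sq[of c] K by (auto simp: power2_eq_square)
    have "a = b \<or> a = - b" "b = c \<or> b = - c"
      using sqs by (metis power2_eq_iff power2_eq_square)+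
    then consider "a = b" | "b = c" | "a = c" by force
    \<comment> \<open>Two equal roots serve as \<alpha> and \<beta>, the third as \<gamma>.\<close>
    then show thesis
    proof cases
      case 1
      then show thesis using three[of a a c] abc sqs by simp
    next
      case 2
      then show thesis using three[of b b a] abc sqs by (simp add: add_mset_commute)
    next
      case 3
      then show thesis using three[of a a b] abc sqs by (simp add: add_mset_commute)
    qed
  qed
qed

section \<open>Covering by a cubic and a quartic family\<close>

lemma Poly_map_coeff:
  assumes "degree w < k"
  shows "Poly (map (coeff w) [0..<k]) = w"
  using assms by (intro poly_eqI) (auto simp: nth_default_def coeff_eq_0)

text \<open>The witness for \<open>r\<close> is the modulus of the first root in the list, which the
  first \<open>k\<close> entries share.\<close>

lemma exactly_max_modulus_roots_size:
  assumes "exactly_max_modulus_roots k f"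
  obtains r where "k \<le> size (filter_mset (\<lambda>z. cmod z = r) (proots f))"
proof -
  obtain rs where rs: "mset rs = proots f" "k \<le> length rs"
      "\<And>i. i < k \<Longrightarrow> cmod (rs ! i) = cmod (rs ! 0)"
    using assms unfolding exactly_max_modulus_roots_def by blast
  let ?P = "\<lambda>z. cmod z = cmod (rs ! 0)"
  have "\<forall>x\<in>set (take k rs). ?P x"
  proof
    fix x assume "x \<in> set (take k rs)"
    then obtain i where "i < k" "x = rs ! i" by (auto simp: in_set_conv_nth)
    then show "?P x" using rs(3) by metis
  qed
  then have "filter ?P (take k rs) = take k rs" by simp
  then have "k = length (filter ?P (take k rs))" using rs(2) by simp
  also have "\<dots> \<le> length (filter ?P (take k rs @ drop k rs))" by (simp only: filter_append) simp
  also have "\<dots> = size (filter_mset ?P (proots f))" by (metis rs(1) mset_filter size_mset append_take_drop_id)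
  finally show ?thesis using that by blast
qed

text \<open>Here \<open>x 0\<close> is \<open>s\<close> and \<open>x 1\<close> is \<open>b\<close>;
  the other \<open>n - 2\<close> parameters are the coefficients of \<open>w\<close>, which also
  carries the leading coefficient.\<close>

definition cubic_family :: "nat \<Rightarrow> (nat \<Rightarrow> complex) \<Rightarrow> complex poly" where
  "cubic_family n x = [:x 0 * x 0, x 1, 1:] * [:x 0, 1:] * Poly (map (\<lambda>i. x (i + 2)) [0..<n - 2])"

text \<open>The constant term \<open>x 0\<close> shared by both quadratics encodes the relation
  between the roots and brings the count down to \<open>n\<close>. For \<open>n = 3\<close> the list
  is empty and the family is zero, in accordance with a cubic not having four roots.\<close>

definition quartic_family :: "nat \<Rightarrow> (nat \<Rightarrow> complex) \<Rightarrow> complex poly" where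
  "quartic_family n x =
     [:x 0, x 1, 1:] * [:x 0, x 2, 1:] * Poly (map (\<lambda>i. x (i + 3)) [0..<n - 3])"

text \<open>The degree bound stays an unevaluated sum, one summand per factor, to match the product
  rule; the 2 comes from \<open>x 0 * x 0\<close>.\<close>

lemma polyfun_family_cubic:
  assumes "n \<ge> 3"
  shows "polyfun_family n (2 + 1 + 1) (cubic_family n)"
proof -
  have "polyfun n (1 + 1) (\<lambda>x. x 0 * x 0 :: complex)"
    using assms by (intro polyfun_mult polyfun_var) auto
  then have "polyfun n 2 (\<lambda>x. x 0 * x 0 :: complex)" by (simp add: numeral_2_eq_2)
  then show ?thesis unfolding cubic_family_def using assms
    by (intro polyfun_family_mult polyfun_family_pCons polyfun_family_Poly polyfun_family_0
        polyfun_const polyfun_var) auto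
qed

lemma polyfun_family_quartic:
  assumes "n \<ge> 3"
  shows "polyfun_family n (1 + 1 + 1) (quartic_family n)"
  unfolding quartic_family_def using assms
  by (intro polyfun_family_mult polyfun_family_pCons polyfun_family_Poly polyfun_family_0
      polyfun_const polyfun_var) auto

lemma A_star_set_subset_families:
  assumes "k \<ge> 3"
  shows "A_star_set n k H \<subseteq>
    {f \<in> polys_of_height n H. map_poly of_int f \<in> range (cubic_family n)} \<union>
    {f \<in> polys_of_height n H. map_poly of_int f \<in> range (quartic_family n)}"
proof
  fix f assume f: "f \<in> A_star_set n k H"
  define g where "g = map_poly (of_int :: int \<Rightarrow> complex) f"
  have g: "exactly_max_modulus_roots k g" "degree g = n" "g \<noteq> 0"
    using f by (auto simp: A_star_set_def g_def degree_map_poly map_poly_eq_0_iff)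
  obtain r where "k \<le> size (filter_mset (\<lambda>z. cmod z = r) (proots g))"
    using exactly_max_modulus_roots_size[OF g(1)] .
  then have size: "3 \<le> size (filter_mset (\<lambda>z. cmod z = r) (proots g))" using assms by simp
  have "image_mset cnj (proots g) = proots g"
    by (rule image_mset_cnj_proots) (simp add: g_def coeff_map_poly)
  from this size have "g \<in> range (cubic_family n) \<union> range (quartic_family n)"
  proof (cases rule: three_conjugation_closed[consumes 2])
    case *: (three \<alpha> \<beta> \<gamma>)
    obtain w where w: "g = (\<Prod>x\<in>#{#\<alpha>, \<beta>, \<gamma>#}. [:-x, 1:]) * w"
      "degree g = size {#\<alpha>, \<beta>, \<gamma>#} + degree w"
      using proots_cofactor[OF g(3) *(1)] .
    \<comment> \<open>Vieta: with \<open>s = -\<gamma>\<close> the constant term \<alpha>\<beta>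
      equals \<open>s\<^sup>2\<close>. The cofactor has degree \<open>n - 3\<close>, so
      \<open>n - 2\<close> coefficients suffice.\<close>
    define x where "x = (\<lambda>j::nat. if j = 0 then - \<gamma> else if j = 1 then - \<alpha> - \<beta> else coeff w (j - 2))"
    have "Poly (map (\<lambda>i. x (i + 2)) [0..<n - 2]) = w"
      using w(2) g(2) Poly_map_coeff[of w "n - 2"] by (simp add: x_def)
    moreover have "[:x 0 * x 0, x 1, 1:] = [:-\<alpha>, 1:] * [:-\<beta>, 1:]"
      using *(2) by (simp add: x_def power2_eq_square mult.commute)
    ultimately have "cubic_family n x = [:-\<alpha>, 1:] * [:-\<beta>, 1:] * [:-\<gamma>, 1:] * w"
      unfolding cubic_family_def by (simp only:) (simp only: x_def if_True simp_thms)
    also have "\<dots> = g" unfolding w(1) by (simp only: image_mset_add_mset prod_mset.add_mset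
          image_mset_empty prod_mset_empty mult_1_right mult.assoc)
    finally show ?thesis by blast
  next
    case *: (four \<alpha> \<beta> \<gamma> \<delta>)
    obtain w where w: "g = (\<Prod>x\<in>#{#\<alpha>, \<beta>, \<gamma>, \<delta>#}. [:-x, 1:]) * w"
      "degree g = size {#\<alpha>, \<beta>, \<gamma>, \<delta>#} + degree w"
      using proots_cofactor[OF g(3) *(1)] .
    define x where "x = (\<lambda>j::nat. if j = 0 then \<alpha> * \<beta> else if j = 1 then - \<alpha> - \<beta>
        else if j = 2 then - \<gamma> - \<delta> else coeff w (j - 3))"
    have "Poly (map (\<lambda>i. x (i + 3)) [0..<n - 3]) = w"
      using w(2) g(2) Poly_map_coeff[of w "n - 3"] by (simp add: x_def)
    moreover have "[:x 0, x 1, 1:] = [:-\<alpha>, 1:] * [:-\<beta>, 1:]" by (simp add: x_def)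
    moreover have "[:x 0, x 2, 1:] = [:-\<gamma>, 1:] * [:-\<delta>, 1:]" using *(2) by (simp add: x_def)
    ultimately have "quartic_family n x = ([:-\<alpha>, 1:] * [:-\<beta>, 1:]) * ([:-\<gamma>, 1:] * [:-\<delta>, 1:]) * w"
      unfolding quartic_family_def by (simp only:)
    also have "\<dots> = g" unfolding w(1) by (simp only: image_mset_add_mset prod_mset.add_mset
          image_mset_empty prod_mset_empty mult_1_right mult.assoc)
    finally show ?thesis by blast
  qed
  moreover have "f \<in> polys_of_height n H" using f by (simp add: A_star_set_def polys_of_height_def)
  ultimately show "f \<in> {f \<in> polys_of_height n H. map_poly of_int f \<in> range (cubic_family n)} \<union>
      {f \<in> polys_of_height n H. map_poly of_int f \<in> range (quartic_family n)}"
    by (auto simp: g_def)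
qed

theorem theorem3p4:
  fixes n :: nat
  assumes "n \<ge> 3"
  shows "\<exists>c::real. c > 0 \<and>
           (\<forall>H::nat. H \<ge> 1 \<longrightarrow> real (\<Sum>k=3..n. A_star n k H) \<le> c * real H ^ n)"
proof -
  let ?B = "\<lambda>G H. {f \<in> polys_of_height n H. map_poly of_int f \<in> range (G n)}"
  obtain C where C: "\<And>H. H \<ge> 1 \<Longrightarrow> finite (?B cubic_family H)"
      "\<And>H. H \<ge> 1 \<Longrightarrow> card (?B cubic_family H) \<le> C * H ^ n"
    using card_polys_in_family_le[OF polyfun_family_cubic[OF assms]] by blast
  obtain D where D: "\<And>H. H \<ge> 1 \<Longrightarrow> finite (?B quartic_family H)"
      "\<And>H. H \<ge> 1 \<Longrightarrow> card (?B quartic_family H) \<le> D * H ^ n"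
    using card_polys_in_family_le[OF polyfun_family_quartic[OF assms]] by blast
  \<comment> \<open>Each of the at most \<open>n\<close> summands is bounded by the size of the same
    two sets; the added 1 keeps the constant positive if \<open>C + D = 0\<close>.\<close>
  have "real (\<Sum>k=3..n. A_star n k H) \<le> real (n * (C + D) + 1) * real H ^ n" if H: "H \<ge> 1" for H
  proof -
    have "A_star n k H \<le> (C + D) * H ^ n" if "k \<ge> 3" for k
    proof -
      have "A_star n k H \<le> card (?B cubic_family H \<union> ?B quartic_family H)"
        unfolding A_star_def using C(1)[OF H] D(1)[OF H]
        by (intro card_mono A_star_set_subset_families that finite_UnI)
      also have "\<dots> \<le> card (?B cubic_family H) + card (?B quartic_family H)" by (rule card_Un_le)
      also have "\<dots> \<le> (C + D) * H ^ n"
        using C(2)[OF H] D(2)[OF H] by (simp add: distrib_right)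
      finally show ?thesis .
    qed
    then have "(\<Sum>k=3..n. A_star n k H) \<le> (\<Sum>k=3..n. (C + D) * H ^ n)"
      by (intro sum_mono) simp
    also have "\<dots> = (n + 1 - 3) * ((C + D) * H ^ n)" by simp
    also have "\<dots> \<le> n * ((C + D) * H ^ n)" by (intro mult_right_mono) auto
    also have "\<dots> \<le> (n * (C + D) + 1) * H ^ n" by (simp only: distrib_right mult.assoc le_add1)
    finally have "real (\<Sum>k=3..n. A_star n k H) \<le> real ((n * (C + D) + 1) * H ^ n)"
      by (rule of_nat_mono)
    then show ?thesis by (simp only: of_nat_mult of_nat_power)
  qed
  moreover have "real (n * (C + D) + 1) > 0" by (subst of_nat_0_less_iff) simp
  ultimately show ?thesis by blast
qed

end
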